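(* Let $E, F, X, Y$ be nontrivial Banach spaces (over the same scalar field $\mathbb{K}$) and suppose that there exists a bounded linear operator $T: E \to F$ which does not attain its norm. Then: (a) the pair $(E \oplus_p X, F \oplus_q Y)$ fails the WMP whenever $1 \leq q < p < \infty$; (b) the pair $(E \oplus_{\infty} X, F)$ fails the WMP.
   Context: Banach spaces are over $\mathbb{K} = \mathbb{R}$ or $\mathbb{C}$; a Banach space is nontrivial if it is not $\{0\}$. $S_E$ is the unit sphere of $E$. $E\oplus_p X$ denotes the direct sum with norm $\|(x,y)\| = (\|x\|^p+\|y\|^p)^{1/p}$ for $1\le p<\infty$, and $\|(x,y)\|=\max\{\|x\|,\|y\|\}$ for $p=\infty$. A bounded linear operator $T:E\to F$ attains its norm if there is $x_0\in S_E$ with $\|T(x_0)\|=\|T\|$. A maximizing sequence for $T$ is a sequence $(x_n)\subset S_E$ with $\|T(x_n)\|\to\|T\|$. A pair $(E,F)$ of Banach spaces has the weak maximizing property (WMP) if every bounded linear operator $T:E\to F$ that admits a non-weakly null maximizing sequence (i.e. one not converging weakly to $0$) attains its norm. *)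

theory Defs
  imports "HOL-Analysis.Analysis"
begin

text \<open>
  The scalar field is a type of the following class, i.e. a copy of \<open>\<real>\<close> or of \<open>\<complex>\<close> with its usual
  absolute value; the types \<^typ>\<open>real\<close> and \<^typ>\<open>complex\<close> themselves are instances.
\<close>

class real_or_complex = real_normed_field +
  assumes real_or_complex:
    "(\<exists>f :: 'a \<Rightarrow> real. bij f \<and> (\<forall>x y. f (x + y) = f x + f y) \<and> (\<forall>r x. f (r *\<^sub>R x) = r *\<^sub>R f x) \<and>
        (\<forall>x y. f (x * y) = f x * f y) \<and> (\<forall>x. norm (f x) = norm x)) \<or>
     (\<exists>f :: 'a \<Rightarrow> complex. bij f \<and> (\<forall>x y. f (x + y) = f x + f y) \<and> (\<forall>r x. f (r *\<^sub>R x) = r *\<^sub>R f x) \<and>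
        (\<forall>x y. f (x * y) = f x * f y) \<and> (\<forall>x. norm (f x) = norm x))"

instance real :: real_or_complex
proof
  show "(\<exists>f :: real \<Rightarrow> real. bij f \<and> (\<forall>x y. f (x + y) = f x + f y) \<and> (\<forall>r x. f (r *\<^sub>R x) = r *\<^sub>R f x) \<and>
        (\<forall>x y. f (x * y) = f x * f y) \<and> (\<forall>x. norm (f x) = norm x)) \<or>
     (\<exists>f :: real \<Rightarrow> complex. bij f \<and> (\<forall>x y. f (x + y) = f x + f y) \<and> (\<forall>r x. f (r *\<^sub>R x) = r *\<^sub>R f x) \<and>
        (\<forall>x y. f (x * y) = f x * f y) \<and> (\<forall>x. norm (f x) = norm x))"
    by (intro disjI1 exI[of _ id]) simp
qed

instance complex :: real_or_complex
proof
  show "(\<exists>f :: complex \<Rightarrow> real. bij f \<and> (\<forall>x y. f (x + y) = f x + f y) \<and> (\<forall>r x. f (r *\<^sub>R x) = r *\<^sub>R f x) \<and>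
        (\<forall>x y. f (x * y) = f x * f y) \<and> (\<forall>x. norm (f x) = norm x)) \<or>
     (\<exists>f :: complex \<Rightarrow> complex. bij f \<and> (\<forall>x y. f (x + y) = f x + f y) \<and> (\<forall>r x. f (r *\<^sub>R x) = r *\<^sub>R f x) \<and>
        (\<forall>x y. f (x * y) = f x * f y) \<and> (\<forall>x. norm (f x) = norm x))"
    by (intro disjI2 exI[of _ id]) simp
qed

text \<open>
  The scalar multiplication and the norm are explicit data, because the library has no class of
  complex Banach spaces and because the same product type \<open>'a \<times> 'b\<close> has to carry a different norm
  for each exponent \<open>p\<close>. The underlying additive group is that of the type.
\<close>

record ('k, 'a) nspace =
  scl :: "'k \<Rightarrow> 'a \<Rightarrow> 'a"
  nrm :: "'a \<Rightarrow> real"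

locale normed_space = vector_space "scl E"
  for E :: "('k::real_or_complex, 'a::ab_group_add) nspace" +
  assumes nrm_eq_0_iff: "nrm E x = 0 \<longleftrightarrow> x = 0"
    and nrm_triangle: "nrm E (x + y) \<le> nrm E x + nrm E y"
    and nrm_scl: "nrm E (scl E c x) = norm c * nrm E x"

locale banach_space = normed_space E
  for E :: "('k::real_or_complex, 'a::ab_group_add) nspace" +
  assumes complete: "Metric_space.mcomplete UNIV (\<lambda>x y. nrm E (x - y))"

definition scalar_space :: "('k::real_or_complex, 'k) nspace" where
  "scalar_space = \<lparr>scl = (*), nrm = norm\<rparr>"

definition bounded_op ::
  "('k::real_or_complex, 'a::ab_group_add) nspace \<Rightarrow> ('k, 'b::ab_group_add) nspace \<Rightarrow> ('a \<Rightarrow> 'b) \<Rightarrow> bool" where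
  "bounded_op E F T \<longleftrightarrow>
     Vector_Spaces.linear (scl E) (scl F) T \<and> (\<exists>B. \<forall>x. nrm F (T x) \<le> B * nrm E x)"

definition op_norm ::
  "('k, 'a) nspace \<Rightarrow> ('k, 'b) nspace \<Rightarrow> ('a \<Rightarrow> 'b) \<Rightarrow> real" where
  "op_norm E F T = (SUP x \<in> {x. nrm E x \<le> 1}. nrm F (T x))"

definition attains_norm ::
  "('k, 'a) nspace \<Rightarrow> ('k, 'b) nspace \<Rightarrow> ('a \<Rightarrow> 'b) \<Rightarrow> bool" where
  "attains_norm E F T \<longleftrightarrow> (\<exists>x. nrm E x = 1 \<and> nrm F (T x) = op_norm E F T)"

definition maximizing_seq ::
  "('k, 'a) nspace \<Rightarrow> ('k, 'b) nspace \<Rightarrow> ('a \<Rightarrow> 'b) \<Rightarrow> (nat \<Rightarrow> 'a) \<Rightarrow> bool" where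
  "maximizing_seq E F T x \<longleftrightarrow>
     (\<forall>n. nrm E (x n) = 1) \<and> (\<lambda>n. nrm F (T (x n))) \<longlonglongrightarrow> op_norm E F T"

definition weakly_null ::
  "('k::real_or_complex, 'a::ab_group_add) nspace \<Rightarrow> (nat \<Rightarrow> 'a) \<Rightarrow> bool" where
  "weakly_null E x \<longleftrightarrow> (\<forall>\<phi>. bounded_op E scalar_space \<phi> \<longrightarrow> (\<lambda>n. \<phi> (x n)) \<longlonglongrightarrow> 0)"

definition WMP ::
  "('k::real_or_complex, 'a::ab_group_add) nspace \<Rightarrow> ('k, 'b::ab_group_add) nspace \<Rightarrow> bool" where
  "WMP E F \<longleftrightarrow>
     (\<forall>T. bounded_op E F T \<and> (\<exists>x. maximizing_seq E F T x \<and> \<not> weakly_null E x)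
        \<longrightarrow> attains_norm E F T)"

definition sum_p ::
  "real \<Rightarrow> ('k, 'a) nspace \<Rightarrow> ('k, 'b) nspace \<Rightarrow> ('k, 'a \<times> 'b) nspace" where
  "sum_p p E X =
     \<lparr>scl = (\<lambda>c (x, y). (scl E c x, scl X c y)),
      nrm = (\<lambda>(x, y). (nrm E x powr p + nrm X y powr p) powr (1 / p))\<rparr>"

definition sum_inf ::
  "('k, 'a) nspace \<Rightarrow> ('k, 'b) nspace \<Rightarrow> ('k, 'a \<times> 'b) nspace" where
  "sum_inf E X =
     \<lparr>scl = (\<lambda>c (x, y). (scl E c x, scl X c y)),
      nrm = (\<lambda>(x, y). max (nrm E x) (nrm X y))\<rparr>"

end

theory Submission
  imports Defs
begin

text \<open>
  Let \<open>T\<close> not attain its norm, and let \<open>(x\<^sub>n)\<close> be maximizing for \<open>T\<close>.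

  For \<open>p < \<infinity>\<close>, pick a nonzero functional \<open>\<phi>\<close> on \<open>X\<close> (Hahn--Banach) and \<open>w\<close> in \<open>Y\<close> such that the rank one
  operator \<open>R = \<phi>(\<cdot>) w\<close> satisfies \<open>\<parallel>R\<parallel> = \<parallel>T\<parallel>\<close>, and put \<open>S (x, y) = (T x, R y)\<close>. By convexity of
  \<open>t \<mapsto> t\<^bsup>p/q\<^esup>\<close>, the norm of \<open>S\<close> is \<open>\<parallel>T\<parallel>\<close> times \<open>2\<^bsup>1/q - 1/p\<^esup>\<close>, and it is approached along
  \<open>(x\<^sub>n, y\<^sub>n)\<close>, normalized, for \<open>(y\<^sub>n)\<close> maximizing for \<open>\<phi>\<close>; this sequence is not weakly null because of \<open>\<phi>\<close>.
  As \<open>q < p\<close>, the factor exceeds 1, so \<open>S\<close> can attain its norm only at some \<open>(x, y)\<close> with \<open>x \<noteq> 0\<close>, where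
  \<open>T\<close> must attain its norm at \<open>x / \<parallel>x\<parallel>\<close>.

  For \<open>p = \<infinity>\<close>, take \<open>S (x, y) = T x\<close> and the sequence \<open>(x\<^sub>n, y)\<close> with a fixed unit vector \<open>y\<close>.
\<close>

section \<open>A Hahn--Banach theorem\<close>

text \<open>The inequality in the second clause already yields equality, by applying it again with
  \<open>1 / t\<close>; it is also the form that passes to infima. The scaling \<open>s\<close> is
  by reals, so that a real or complex space enters with its scalars restricted to the reals.\<close>

definition sublinear :: "(real \<Rightarrow> 'a \<Rightarrow> 'a) \<Rightarrow> ('a::ab_group_add \<Rightarrow> real) \<Rightarrow> bool" where
  "sublinear s q \<longleftrightarrow> (\<forall>x y. q (x + y) \<le> q x + q y) \<and> (\<forall>t\<ge>0. \<forall>x. q (s t x) \<le> t * q x)"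

lemma sublinear_add: "sublinear s q \<Longrightarrow> q (x + y) \<le> q x + q y"
  and sublinear_scale_le: "sublinear s q \<Longrightarrow> 0 \<le> t \<Longrightarrow> q (s t x) \<le> t * q x"
  by (auto simp: sublinear_def)

lemma sublinear_zero:
  assumes "vector_space s" and q: "sublinear s q"
  shows "q 0 = 0"
proof -
  interpret vector_space s by fact
  have "q 0 \<le> 0" using sublinear_scale_le[OF q, of 0 0] by simp
  moreover have "q 0 \<le> q 0 + q 0" using sublinear_add[OF q, of 0 0] by simp
  ultimately show ?thesis by simp
qed

lemma sublinear_scale:
  assumes "vector_space s" and q: "sublinear s q" and "0 \<le> t"
  shows "q (s t x) = t * q x"
proof (cases "t = 0")
  case True
  interpret vector_space s by fact
  show ?thesis using sublinear_zero[OF assms(1,2)] True by simp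
next
  case False
  interpret vector_space s by fact
  have "q (s (1/t) (s t x)) \<le> (1/t) * q (s t x)"
    using \<open>0 \<le> t\<close> by (intro sublinear_scale_le[OF q]) simp
  then have "t * q x \<le> q (s t x)" using False \<open>0 \<le> t\<close> by (simp add: field_simps)
  with sublinear_scale_le[OF q \<open>0 \<le> t\<close>, of x] show ?thesis by simp
qed

lemma sublinear_minus_le:
  assumes "vector_space s" and q: "sublinear s q"
  shows "- q (- x) \<le> q x"
  using sublinear_zero[OF assms] sublinear_add[OF q, of x "- x"] by simp

text \<open>
  A pointwise minimal sublinear functional agrees with all its \<open>ray_reduct\<close>s, which forces it to be
  linear. Minimality thus replaces the usual extension of functionals from subspaces.
\<close>

definition ray_reduct ::
  "(real \<Rightarrow> 'a \<Rightarrow> 'a) \<Rightarrow> ('a::ab_group_add \<Rightarrow> real) \<Rightarrow> 'a \<Rightarrow> 'a \<Rightarrow> real" where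
  "ray_reduct s q y x = (INF t\<in>{0..}. q (x + s t y) - t * q y)"

lemma ray_reduct_le:
  assumes "vector_space s" and q: "sublinear s q" and "0 \<le> t"
  shows "ray_reduct s q y x \<le> q (x + s t y) - t * q y"
  unfolding ray_reduct_def
proof (rule cINF_lower)
  \<comment> \<open>This lower bound does not depend on \<open>t\<close>, so the infimum over
    \<open>t\<close> is a genuine one.\<close>
  have "- q (- x) \<le> q (x + s t y) - t * q y" if "0 \<le> t" for t
    using sublinear_add[OF q, of "x + s t y" "- x"] sublinear_scale[OF assms(1,2) that, of y]
    by simp
  then show "bdd_below ((\<lambda>t. q (x + s t y) - t * q y) ` {0..})"
    by (intro bdd_belowI2[where m = "- q (- x)"]) auto
qed (use assms in simp)

lemma ray_reduct_le_self:
  assumes "vector_space s" and "sublinear s q"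
  shows "ray_reduct s q y x \<le> q x"
proof -
  interpret vector_space s by fact
  show ?thesis using ray_reduct_le[OF assms, of 0 y x] by simp
qed

text \<open>If \<open>t1\<close> and \<open>t2\<close> are parameters for \<open>x1\<close> and
  \<open>x2\<close>, then \<open>t1 + t2\<close> serves for \<open>x1 + x2\<close>; if
  \<open>t\<close> is one for \<open>x\<close>, then \<open>r * t\<close> serves for
  \<open>s r x\<close>. Both clauses follow by taking infima, one parameter at a time.\<close>

lemma sublinear_ray_reduct:
  assumes vs: "vector_space s" and q: "sublinear s q"
  shows "sublinear s (ray_reduct s q y)"
  unfolding sublinear_def
proof (intro conjI allI impI)
  interpret vector_space s by fact
  let ?r = "ray_reduct s q y"
  let ?g = "\<lambda>x t. q (x + s t y) - t * q y"
  fix x1 x2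
  have "?r (x1 + x2) \<le> ?g x1 t1 + ?g x2 t2" if "0 \<le> t1" "0 \<le> t2" for t1 t2
  proof -
    have "?r (x1 + x2) \<le> ?g (x1 + x2) (t1 + t2)"
      using that by (intro ray_reduct_le[OF vs q]) simp
    moreover have "x1 + x2 + s (t1 + t2) y = (x1 + s t1 y) + (x2 + s t2 y)"
      by (simp add: scale_left_distrib)
    ultimately show ?thesis
      using sublinear_add[OF q, of "x1 + s t1 y" "x2 + s t2 y"] by (simp add: algebra_simps)
  qed
  then have "?r (x1 + x2) - ?g x2 t2 \<le> ?r x1" if "0 \<le> t2" for t2
    unfolding ray_reduct_def[of s q y x1]
    using that by (intro cINF_greatest) (auto simp: algebra_simps)
  then have "?r (x1 + x2) - ?r x1 \<le> ?r x2"
    unfolding ray_reduct_def[of s q y x2]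
    by (intro cINF_greatest) (auto simp: algebra_simps)
  then show "?r (x1 + x2) \<le> ?r x1 + ?r x2" by simp
next
  interpret vector_space s by fact
  let ?r = "ray_reduct s q y"
  fix r :: real and x
  assume "0 \<le> r"
  show "?r (s r x) \<le> r * ?r x"
  proof (cases "r = 0")
    case True
    have "?r 0 \<le> q 0" by (rule ray_reduct_le_self[OF vs q])
    with True sublinear_zero[OF vs q] show ?thesis by simp
  next
    case False
    with \<open>0 \<le> r\<close> have r: "r > 0" by simp
    have "?r (s r x) / r \<le> q (x + s t y) - t * q y" if "0 \<le> t" for t
    proof -
      have "?r (s r x) \<le> q (s r x + s (r * t) y) - (r * t) * q y"
        using r that by (intro ray_reduct_le[OF vs q]) simp
      also have "s r x + s (r * t) y = s r (x + s t y)"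
        by (simp add: scale_right_distrib)
      also have "q \<dots> = r * q (x + s t y)"
        using r by (intro sublinear_scale[OF vs q]) simp
      finally show ?thesis using r by (simp add: field_simps)
    qed
    then have "?r (s r x) / r \<le> ?r x"
      unfolding ray_reduct_def[of s q y x] by (intro cINF_greatest) auto
    with r show ?thesis by (simp add: field_simps)
  qed
qed

text \<open>Subadditivity rests on the chain: the smaller of \<open>q1\<close> and \<open>q2\<close>
  bounds \<open>u (x + y)\<close> by \<open>q1 x + q2 y\<close>. The infimum is finite because each
  member satisfies \<open>q x \<ge> - q (- x) \<ge> - p (- x)\<close>.\<close>

lemma sublinear_INF_chain:
  assumes vs: "vector_space s" and C: "C \<noteq> {}" "\<And>q. q \<in> C \<Longrightarrow> sublinear s q \<and> q \<le> p"
    and chain: "\<And>q1 q2. q1 \<in> C \<Longrightarrow> q2 \<in> C \<Longrightarrow> q1 \<le> q2 \<or> q2 \<le> q1"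
  defines "u \<equiv> \<lambda>x. INF q\<in>C. q x"
  shows "sublinear s u" and "\<And>q. q \<in> C \<Longrightarrow> u \<le> q"
proof -
  have "bdd_below ((\<lambda>q. q x) ` C)" for x
  proof (rule bdd_belowI2)
    fix q assume "q \<in> C"
    with C have "sublinear s q" and "q (- x) \<le> p (- x)" by (auto simp: le_fun_def)
    with sublinear_minus_le[OF vs, of q x] show "- p (- x) \<le> q x" by simp
  qed
  then have low: "u x \<le> q x" if "q \<in> C" for q x
    using that unfolding u_def by (intro cINF_lower)
  have greatest: "v \<le> u x" if "\<And>q. q \<in> C \<Longrightarrow> v \<le> q x" for v x
    unfolding u_def using that C(1) by (intro cINF_greatest)
  from low show "u \<le> q" if "q \<in> C" for q using that by (simp add: le_fun_def)
  show "sublinear s u"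
    unfolding sublinear_def
  proof (intro conjI allI impI)
    fix x y
    have "u (x + y) \<le> q1 x + q2 y" if q12: "q1 \<in> C" "q2 \<in> C" for q1 q2
    proof -
      obtain q where q: "q \<in> C" "q \<le> q1" "q \<le> q2"
        using chain[OF q12] q12 by auto
      have "u (x + y) \<le> q (x + y)" using q low by simp
      also have "\<dots> \<le> q x + q y" using C q sublinear_add by blast
      also have "\<dots> \<le> q1 x + q2 y" using q by (intro add_mono) (auto simp: le_fun_def)
      finally show ?thesis .
    qed
    then have "u (x + y) - q2 y \<le> u x" if "q2 \<in> C" for q2
      using that by (intro greatest) (auto simp: algebra_simps)
    then have "u (x + y) - u x \<le> u y"
      by (intro greatest) (auto simp: algebra_simps)
    then show "u (x + y) \<le> u x + u y" by simp
  next
    fix t :: real and x assume t: "0 \<le> t"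
    show "u (s t x) \<le> t * u x"
    proof (cases "t = 0")
      case True
      interpret vector_space s by fact
      obtain q where "q \<in> C" using C by auto
      then have "u 0 \<le> 0" using low[of q 0] C sublinear_zero[OF vs] by fastforce
      with True show ?thesis by simp
    next
      case False
      with t have t: "t > 0" by simp
      have "u (s t x) / t \<le> q x" if "q \<in> C" for q
        using low[OF that, of "s t x"] sublinear_scale_le[of s q t x] C(2)[OF that] t
        by (simp add: field_simps)
      then have "u (s t x) / t \<le> u x" by (rule greatest)
      with t show ?thesis by (simp add: field_simps)
    qed
  qed
qed

lemma exists_minimal_sublinear:
  assumes vs: "vector_space s" and p: "sublinear s p"
  shows "\<exists>m. sublinear s m \<and> m \<le> p \<and> (\<forall>q. sublinear s q \<longrightarrow> q \<le> m \<longrightarrow> q = m)"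
proof -
  let ?A = "{q. sublinear s q \<and> q \<le> p}"
  \<comment> \<open>Reversing the order turns the maximal element of Zorn's lemma into a minimal
    functional, and the upper bound of a chain into its pointwise infimum.\<close>
  let ?P = "\<lambda>q r. r \<le> q"
  have "\<exists>m\<in>?A. \<forall>q\<in>?A. ?P m q \<longrightarrow> q = m"
  proof (rule predicate_Zorn)
    show "partial_order_on ?A (relation_of ?P ?A)"
      by (rule partial_order_on_relation_ofI) auto
    fix C assume "C \<in> Chains (relation_of ?P ?A)"
    then have C: "\<And>q. q \<in> C \<Longrightarrow> sublinear s q \<and> q \<le> p"
      and chain: "\<And>q1 q2. q1 \<in> C \<Longrightarrow> q2 \<in> C \<Longrightarrow> q1 \<le> q2 \<or> q2 \<le> q1"
      by (auto simp: Chains_def relation_of_def)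
    show "\<exists>u\<in>?A. \<forall>a\<in>C. ?P a u"
    proof (cases "C = {}")
      case True
      then show ?thesis using p by auto
    next
      case False
      note u = sublinear_INF_chain[OF vs False C chain]
      obtain q where "q \<in> C" using False by auto
      with u(2) C have "(\<lambda>x. INF q\<in>C. q x) \<le> p" by (metis order_trans)
      with u show ?thesis by blast
    qed
  qed
  then show ?thesis by (auto intro: order_trans)
qed

text \<open>By minimality \<open>ray_reduct s m y = m\<close>. The parameter 1 in its infimum then
  gives \<open>m x \<le> m (x + y) - m y\<close>, the converse of subadditivity. Additivity makes
  \<open>m\<close> odd, which settles negative scalars.\<close>

lemma minimal_sublinear_linear:
  assumes vs: "vector_space s" and m: "sublinear s m"
    and min: "\<And>q. sublinear s q \<Longrightarrow> q \<le> m \<Longrightarrow> q = m"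
  shows "m (x + y) = m x + m y" and "m (s t x) = t * m x"
proof -
  interpret vector_space s by fact
  have add: "m (x + y) = m x + m y" for x y
  proof -
    have "ray_reduct s m y = m"
      using ray_reduct_le_self[OF vs m]
      by (intro min sublinear_ray_reduct[OF vs m]) (simp add: le_fun_def)
    then have "m x \<le> m (x + y) - m y"
      using ray_reduct_le[OF vs m, of 1 y x] by simp
    with sublinear_add[OF m, of x y] show ?thesis by simp
  qed
  then show "m (x + y) = m x + m y" .
  have neg: "m (- x) = - m x" for x
    using add[of x "- x"] sublinear_zero[OF vs m] by simp
  show "m (s t x) = t * m x"
  proof (cases "0 \<le> t")
    case True
    then show ?thesis by (rule sublinear_scale[OF vs m])
  next
    case False
    then show ?thesis using sublinear_scale[OF vs m, of "- t" x] neg[of "s t x"] by simp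
  qed
qed

text \<open>The minimal functional is sought below \<open>ray_reduct s p x0\<close> rather than just
  below \<open>p\<close>. At \<open>- x0\<close>, the parameter 1 forces
  \<open>f (- x0) \<le> - p x0\<close>, and so \<open>f\<close> touches \<open>p\<close> at
  \<open>x0\<close>.\<close>

theorem Hahn_Banach_sublinear:
  assumes vs: "vector_space s" and p: "sublinear s p"
  obtains f where "\<And>x y. f (x + y) = f x + f y" "\<And>t x. f (s t x) = t * f x"
    "\<And>x. f x \<le> p x" "f x0 = p x0"
proof -
  interpret vector_space s by fact
  obtain f where f: "sublinear s f" "f \<le> ray_reduct s p x0"
    "\<And>q. sublinear s q \<Longrightarrow> q \<le> f \<Longrightarrow> q = f"
    using exists_minimal_sublinear[OF vs sublinear_ray_reduct[OF vs p, of x0]] by blast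
  note lin = minimal_sublinear_linear[OF vs f(1,3)]
  have le: "f x \<le> p x" for x
    using le_funD[OF f(2)] ray_reduct_le_self[OF vs p] by (rule order_trans)
  have "f (- x0) \<le> ray_reduct s p x0 (- x0)" using f(2) by (simp add: le_fun_def)
  also have "\<dots> \<le> - p x0"
    using ray_reduct_le[OF vs p, of 1 x0 "- x0"] sublinear_zero[OF vs p] by simp
  finally have "f (- x0) \<le> - p x0" .
  moreover have "f (- x0) = - f x0" using lin(2)[of "-1" x0] by simp
  ultimately have "f x0 = p x0" using le[of x0] by simp
  with lin le show thesis by (rule that)
qed

section \<open>Functionals on normed spaces\<close>

text \<open>Pulls the structure of the reals or complex numbers back along the isomorphism, so that
  later arguments can split cases inside the scalar type itself.\<close>

lemma real_or_complex_decomp: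
  obtains (real) "\<And>c :: 'k::real_or_complex. \<exists>a. c = of_real a"
  | (complex) i :: "'k::real_or_complex" where "i * i = -1" "norm i = 1"
      "\<And>c :: 'k::real_or_complex. \<exists>a b. c = of_real a + of_real b * i"
proof -
  consider f :: "'k \<Rightarrow> real" where "bij f" "\<And>x y. f (x + y) = f x + f y"
      "\<And>r x. f (r *\<^sub>R x) = r *\<^sub>R f x" "\<And>x y. f (x * y) = f x * f y" "\<And>x. norm (f x) = norm x"
    | f :: "'k \<Rightarrow> complex" where "bij f" "\<And>x y. f (x + y) = f x + f y"
      "\<And>r x. f (r *\<^sub>R x) = r *\<^sub>R f x" "\<And>x y. f (x * y) = f x * f y" "\<And>x. norm (f x) = norm x"
    using real_or_complex[where 'a = 'k] by blast
  then show thesis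
  proof cases
    case (1 f)
    \<comment> \<open>Multiplicativity makes \<open>f 1\<close> idempotent, and its norm 1 excludes
      the value 0.\<close>
    have f1: "f 1 = 1"
      using 1(4)[of 1 1] 1(5)[of 1] by auto
    have "c = of_real (f c)" for c
      using 1(3)[of "f c" 1] f1 bij_is_inj[OF 1(1)] by (simp add: of_real_def inj_eq)
    then show thesis using real by blast
  next
    case (2 f)
    have inj: "f x = f y \<longleftrightarrow> x = y" for x y
      using bij_is_inj[OF 2(1)] by (rule inj_eq)
    have f1: "f 1 = 1"
      using 2(4)[of 1 1] 2(5)[of 1] by auto
    have fr: "f (of_real a) = of_real a" for a
      using 2(3)[of a 1] f1 by (simp add: of_real_def)
    obtain i where i: "f i = \<i>" using bij_is_surj[OF 2(1)] by (metis surjD)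
    show thesis
    proof (rule complex)
      have "f (i * i) = f (of_real (-1))" unfolding 2(4) fr i by simp
      then show "i * i = - 1" unfolding inj by simp
      show "norm i = 1" using 2(5)[of i] i by simp
      fix c
      have "f c = f (of_real (Re (f c)) + of_real (Im (f c)) * i)"
        unfolding 2(2,4) fr i by (simp add: complex_eq mult.commute)
      then show "\<exists>a b. c = of_real a + of_real b * i" unfolding inj by blast
    qed
  qed
qed

context normed_space
begin

lemma nrm_zero [simp]: "nrm E 0 = 0"
  by (simp add: nrm_eq_0_iff)

lemma nrm_nonneg [simp]: "0 \<le> nrm E x"
proof -
  have "nrm E (- x) = nrm E x" using nrm_scl[of "-1" x] by simp
  with nrm_triangle[of x "- x"] show ?thesis by simp
qed

lemma nrm_pos_iff: "0 < nrm E x \<longleftrightarrow> x \<noteq> 0"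
  using nrm_nonneg[of x] nrm_eq_0_iff[of x] by linarith

lemma exists_nrm_eq:
  assumes "x \<noteq> 0" and "0 \<le> r"
  shows "nrm E (scl E (of_real (r / nrm E x)) x) = r"
  using assms by (simp add: nrm_scl nrm_eq_0_iff del: of_real_divide)

text \<open>Hahn-Banach over the real scalars, dominated by \<open>nrm E\<close>, gives a real
  functional \<open>u\<close> with \<open>u x0 = nrm E x0\<close>. Over complex scalars
  \<open>u\<close> is then complexified.\<close>

lemma exists_functional:
  assumes "x0 \<noteq> 0"
  obtains \<phi> where "bounded_op E scalar_space \<phi>" "\<phi> x0 \<noteq> 0"
proof -
  let ?s = "\<lambda>r. scl E (of_real r)"
  have vs: "vector_space ?s"
    by unfold_locales (auto simp: scale_right_distrib scale_left_distrib)
  have p: "sublinear ?s (nrm E)"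
    by (auto simp: sublinear_def nrm_triangle nrm_scl)
  obtain u where add: "\<And>x y. u (x + y) = u x + u y"
    and scale: "\<And>t x. u (?s t x) = t * u x"
    and le: "\<And>x. u x \<le> nrm E x" and u0: "u x0 = nrm E x0"
    using Hahn_Banach_sublinear[OF vs p, of x0] by blast
  have neg: "u (- x) = - u x" for x using scale[of "-1" x] by simp
  have nrm_neg: "nrm E (- x) = nrm E x" for x using nrm_scl[of "-1" x] by simp
  have ab: "\<bar>u x\<bar> \<le> nrm E x" for x
    using le[of x] le[of "- x"] by (simp add: neg nrm_neg abs_le_iff)
  have pos: "0 < u x0" using assms u0 by (simp add: nrm_pos_iff)
  have vs_scalar: "vector_space (scl (scalar_space :: ('k, 'k) nspace))"
    by unfold_locales (auto simp: scalar_space_def algebra_simps)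
  have "\<exists>\<phi>. bounded_op E scalar_space \<phi> \<and> \<phi> x0 \<noteq> 0"
  proof (cases rule: real_or_complex_decomp[where 'k = 'k])
    case real
    let ?\<phi> = "\<lambda>x. of_real (u x) :: 'k"
    have "?\<phi> (scl E c x) = c * ?\<phi> x" for c x
    proof -
      obtain a where "c = of_real a" using real by blast
      then show ?thesis by (simp add: scale)
    qed
    then have "Vector_Spaces.linear (scl E) (scl scalar_space) ?\<phi>"
      using vs_scalar vector_space_axioms
      by (simp add: Vector_Spaces.linear_iff add scalar_space_def)
    moreover have "\<forall>x. nrm scalar_space (?\<phi> x) \<le> 1 * nrm E x"
      using ab by (simp add: scalar_space_def)
    moreover have "?\<phi> x0 \<noteq> 0" using pos by simp
    ultimately show ?thesis unfolding bounded_op_def by blast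
  next
    case (complex i)
    \<comment> \<open>The only complex-linear functional with real part \<open>u\<close>.\<close>
    let ?\<phi> = "\<lambda>x. of_real (u x) - i * of_real (u (scl E i x)) :: 'k"
    have ii: "u (scl E i (scl E i x)) = - u x" for x
      by (simp add: complex(1) neg)
    have scl_i: "?\<phi> (scl E i x) = i * ?\<phi> x" for x
    proof -
      have "i * ?\<phi> x = i * of_real (u x) - (i * i) * of_real (u (scl E i x))"
        by (simp add: algebra_simps)
      then show ?thesis by (simp only: complex(1) ii) simp
    qed
    have add': "?\<phi> (x + y) = ?\<phi> x + ?\<phi> y" for x y
      by (simp add: add scale_right_distrib algebra_simps)
    have scl_r: "?\<phi> (scl E (of_real a) x) = of_real a * ?\<phi> x" for a x
    proof -
      have "scl E i (scl E (of_real a) x) = scl E (of_real a) (scl E i x)"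
        by (simp add: mult.commute)
      then show ?thesis by (simp only: scale) (simp add: algebra_simps)
    qed
    have "?\<phi> (scl E c x) = c * ?\<phi> x" for c x
    proof -
      obtain a b where c: "c = of_real a + of_real b * i" using complex(3) by blast
      have "scl E c x = scl E (of_real a) x + scl E (of_real b) (scl E i x)"
        by (simp add: c scale_left_distrib)
      then have "?\<phi> (scl E c x) = of_real a * ?\<phi> x + of_real b * (i * ?\<phi> x)"
        by (simp only: add' scl_r scl_i)
      also have "\<dots> = c * ?\<phi> x" by (simp add: c algebra_simps)
      finally show ?thesis .
    qed
    then have "Vector_Spaces.linear (scl E) (scl scalar_space) ?\<phi>"
      unfolding Vector_Spaces.linear_iff using vs_scalar vector_space_axioms add'
      by (simp add: scalar_space_def)
    \<comment> \<open>The factor 2 comes from estimating the two summands separately; only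
      boundedness is claimed.\<close>
    moreover have "\<forall>x. nrm scalar_space (?\<phi> x) \<le> 2 * nrm E x"
    proof
      fix x
      have "norm (?\<phi> x) \<le> \<bar>u x\<bar> + norm i * \<bar>u (scl E i x)\<bar>"
        by (rule order_trans[OF norm_triangle_ineq4]) (simp add: norm_mult)
      then show "nrm scalar_space (?\<phi> x) \<le> 2 * nrm E x"
        using ab[of x] ab[of "scl E i x"] by (simp add: scalar_space_def nrm_scl complex(2))
    qed
    \<comment> \<open>Vanishing would mean \<open>a = i * b\<close> with real \<open>a\<close> and
      \<open>b\<close>; squaring gives \<open>a * a + b * b = 0\<close>, against
      \<open>0 < u x0\<close>.\<close>
    moreover have "?\<phi> x0 \<noteq> 0"
    proof
      assume 0: "?\<phi> x0 = 0"
      let ?a = "u x0" and ?b = "u (scl E i x0)"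
      have "of_real ?a * of_real ?a = (i * of_real ?b) * (i * of_real ?b :: 'k)"
        using 0 by simp
      also have "\<dots> = (i * i) * of_real (?b * ?b)"
        by (simp add: algebra_simps)
      finally have "of_real (?a * ?a + ?b * ?b) = (0 :: 'k)"
        by (simp add: complex(1))
      then have "?a * ?a + ?b * ?b = 0" by (simp only: of_real_eq_0_iff)
      with pos show False by (simp add: add_nonneg_eq_0_iff)
    qed
    ultimately show ?thesis unfolding bounded_op_def by blast
  qed
  with that show thesis by blast
qed

end

lemma normed_space_scalar: "normed_space (scalar_space :: ('k::real_or_complex, 'k) nspace)"
  by unfold_locales
    (auto simp: scalar_space_def algebra_simps norm_mult intro: norm_triangle_ineq)

section \<open>Operator norms and maximizing sequences\<close>

lemma op_norm_le:
  assumes "normed_space E" and "\<And>x. nrm F (T x) \<le> M * nrm E x" and "0 \<le> M"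
  shows "op_norm E F T \<le> M"
proof -
  interpret normed_space E by fact
  have "nrm F (T x) \<le> M" if "nrm E x \<le> 1" for x
    using assms(2)[of x] mult_left_mono[OF that \<open>0 \<le> M\<close>] by simp
  moreover have "{x. nrm E x \<le> 1} \<noteq> {}" using nrm_zero by (metis empty_Collect_eq zero_le_one)
  ultimately show ?thesis unfolding op_norm_def by (intro cSUP_least) auto
qed

lemma nrm_le_op_norm:
  assumes E: "normed_space E" and F: "normed_space F" and T: "bounded_op E F T"
  shows "nrm F (T x) \<le> op_norm E F T * nrm E x"
proof -
  interpret E: normed_space E by fact
  interpret F: normed_space F by fact
  interpret T: Vector_Spaces.linear "scl E" "scl F" T
    using T by (simp add: bounded_op_def)
  show ?thesis
  proof (cases "x = 0")
    case True
    then show ?thesis by simp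
  next
    case False
    then have n: "0 < nrm E x" by (simp add: E.nrm_pos_iff)
    obtain B where B: "\<And>x. nrm F (T x) \<le> B * nrm E x" using T by (auto simp: bounded_op_def)
    have "nrm F (T z) \<le> \<bar>B\<bar>" if "nrm E z \<le> 1" for z
    proof -
      have "nrm F (T z) \<le> \<bar>B\<bar> * nrm E z"
        using B[of z] mult_right_mono[OF abs_ge_self[of B] E.nrm_nonneg[of z]] by simp
      also have "\<dots> \<le> \<bar>B\<bar> * 1" using that by (intro mult_left_mono) auto
      finally show ?thesis by simp
    qed
    then have bdd: "bdd_above ((\<lambda>x. nrm F (T x)) ` {x. nrm E x \<le> 1})"
      by (intro bdd_aboveI2) auto
    let ?z = "scl E (of_real (1 / nrm E x)) x"
    have "nrm E ?z = 1" using False by (rule E.exists_nrm_eq) simp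
    then have "nrm F (T ?z) \<le> op_norm E F T"
      unfolding op_norm_def by (intro cSUP_upper bdd) simp
    moreover have "nrm F (T ?z) = nrm F (T x) / nrm E x"
      using n by (simp add: T.scale F.nrm_scl norm_divide)
    ultimately show ?thesis using n by (simp only: pos_divide_le_eq)
  qed
qed

lemma op_norm_nonneg:
  fixes E :: "('k::real_or_complex, 'a::ab_group_add) nspace" and x :: 'a
  assumes "normed_space E" "normed_space F" "bounded_op E F T" "x \<noteq> 0"
  shows "0 \<le> op_norm E F T"
proof -
  interpret E: normed_space E by fact
  interpret F: normed_space F by fact
  have "0 \<le> op_norm E F T * nrm E x"
    using nrm_le_op_norm[OF assms(1-3)] F.nrm_nonneg order_trans by blast
  moreover have "0 < nrm E x" using assms(4) by (simp add: E.nrm_pos_iff)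
  ultimately show ?thesis by (simp add: zero_le_mult_iff)
qed

text \<open>The supremum in \<open>op_norm\<close> runs over the ball, the sequence over the sphere.
  If no unit vector came within \<open>1 / Suc n\<close> of the norm, homogeneity would carry the
  smaller bound to all vectors and lower the norm. A unit vector, available by nontriviality, shows
  that the smaller bound is nonnegative.\<close>

lemma exists_maximizing_seq:
  fixes E :: "('k::real_or_complex, 'a::ab_group_add) nspace"
  assumes E: "normed_space E" and F: "normed_space F" and T: "bounded_op E F T"
    and nontriv: "\<exists>x::'a. x \<noteq> 0"
  obtains x where "maximizing_seq E F T x"
proof -
  interpret E: normed_space E by fact
  interpret F: normed_space F by fact
  interpret T: Vector_Spaces.linear "scl E" "scl F" T
    using T by (simp add: bounded_op_def)
  let ?N = "op_norm E F T"
  have "\<exists>x. nrm E x = 1 \<and> ?N - 1 / real (Suc n) < nrm F (T x)" for n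
  proof (rule ccontr)
    assume *: "\<not> ?thesis"
    let ?M = "?N - 1 / real (Suc n)"
    have unit: "nrm F (T x) \<le> ?M" if "nrm E x = 1" for x
      using * that by (auto simp: not_less)
    obtain x1 where x1: "nrm E x1 = 1"
      using nontriv E.exists_nrm_eq[of _ 1] by auto
    have "nrm F (T x) \<le> ?M * nrm E x" for x
    proof (cases "x = 0")
      case False
      then have "0 < nrm E x" by (simp add: E.nrm_pos_iff)
      moreover have "nrm F (T (scl E (of_real (1 / nrm E x)) x)) \<le> ?M"
        using False by (intro unit E.exists_nrm_eq) auto
      moreover have "nrm F (T (scl E (of_real (1 / nrm E x)) x)) = nrm F (T x) / nrm E x"
        using \<open>0 < nrm E x\<close> by (simp add: T.scale F.nrm_scl norm_divide)
      ultimately show ?thesis by (simp add: pos_divide_le_eq)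
    qed simp
    moreover have "0 \<le> ?M" using unit[OF x1] F.nrm_nonneg order_trans by blast
    ultimately have "?N \<le> ?M" by (intro op_norm_le[OF E])
    then show False by simp
  qed
  then obtain x where x: "\<And>n. nrm E (x n) = 1" "\<And>n. ?N - 1 / real (Suc n) < nrm F (T (x n))"
    by metis
  have "(\<lambda>n. nrm F (T (x n))) \<longlonglongrightarrow> ?N"
  proof (rule tendsto_sandwich)
    show "(\<lambda>n. ?N - 1 / real (Suc n)) \<longlonglongrightarrow> ?N"
      using tendsto_diff[OF tendsto_const LIMSEQ_inverse_real_of_nat, of ?N]
      by (simp add: inverse_eq_divide)
    show "\<forall>\<^sub>F n in sequentially. ?N - 1 / real (Suc n) \<le> nrm F (T (x n))"
      using x(2) by (simp add: less_imp_le)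
    show "\<forall>\<^sub>F n in sequentially. nrm F (T (x n)) \<le> ?N"
      using nrm_le_op_norm[OF E F T] x(1) by (metis (no_types, lifting) eventuallyI mult.right_neutral)
  qed simp
  with x(1) show thesis by (intro that[of x]) (simp add: maximizing_seq_def)
qed

lemma attains_norm_if_nrm_eq:
  assumes E: "normed_space E" and F: "normed_space F" and T: "bounded_op E F T"
    and x: "x \<noteq> 0" "nrm F (T x) = op_norm E F T * nrm E x"
  shows "attains_norm E F T"
proof -
  interpret E: normed_space E by fact
  interpret F: normed_space F by fact
  interpret T: Vector_Spaces.linear "scl E" "scl F" T
    using T by (simp add: bounded_op_def)
  let ?z = "scl E (of_real (1 / nrm E x)) x"
  have "0 < nrm E x" using x by (simp add: E.nrm_pos_iff)
  then have "nrm F (T ?z) = op_norm E F T"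
    using x(2) by (simp add: T.scale F.nrm_scl norm_divide)
  moreover have "nrm E ?z = 1" using x(1) by (rule E.exists_nrm_eq) simp
  ultimately show ?thesis unfolding attains_norm_def by blast
qed

text \<open>An operator of norm 0 attains it at every unit vector.\<close>

lemma op_norm_pos_if_not_attains_norm:
  fixes E :: "('k::real_or_complex, 'a::ab_group_add) nspace"
  assumes E: "normed_space E" and F: "normed_space F" and T: "bounded_op E F T"
    and nontriv: "\<exists>x::'a. x \<noteq> 0" and "\<not> attains_norm E F T"
  shows "0 < op_norm E F T"
proof (rule ccontr)
  interpret F: normed_space F by fact
  obtain x :: 'a where x: "x \<noteq> 0" using nontriv by blast
  assume "\<not> 0 < op_norm E F T"
  with op_norm_nonneg[OF E F T x] have 0: "op_norm E F T = 0" by simp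
  then have "nrm F (T x) = op_norm E F T * nrm E x"
    using nrm_le_op_norm[OF E F T, of x] F.nrm_nonneg[of "T x"] by simp
  with attains_norm_if_nrm_eq[OF E F T x] assms(5) show False by simp
qed

text \<open>
  No norm axioms are assumed of \<open>D\<close> and \<open>G\<close>, so Minkowski's inequality is never needed for \<open>sum_p\<close>.
\<close>

lemma op_norm_eqI:
  assumes le: "\<And>z. nrm G (S z) \<le> M * nrm D z" and "0 \<le> M"
    and z: "\<And>n. nrm D (z n) = 1" "(\<lambda>n. nrm G (S (z n))) \<longlonglongrightarrow> M"
  shows "op_norm D G S = M"
proof (rule antisym)
  have le': "nrm G (S x) \<le> M" if "nrm D x \<le> 1" for x
    using le[of x] mult_left_mono[OF that \<open>0 \<le> M\<close>] by simp
  have "z 0 \<in> {x. nrm D x \<le> 1}" using z(1) by simp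
  then show "op_norm D G S \<le> M" unfolding op_norm_def by (intro cSUP_least) (auto intro: le')
  have "bdd_above ((\<lambda>x. nrm G (S x)) ` {x. nrm D x \<le> 1})"
    by (rule bdd_aboveI2[where M = M]) (use le' in auto)
  then have "nrm G (S (z n)) \<le> op_norm D G S" for n
    unfolding op_norm_def using z(1) by (intro cSUP_upper) auto
  with z(2) show "M \<le> op_norm D G S" by (intro LIMSEQ_le_const2) auto
qed

text \<open>The upper bound and the sequence together certify \<open>M\<close> as the operator norm,
  so a counterexample only requires estimates for \<open>S\<close> and \<open>z\<close>.\<close>

lemma not_WMP_I:
  assumes "Vector_Spaces.linear (scl D) (scl G) S"
    and "\<And>z. nrm G (S z) \<le> M * nrm D z" and "0 \<le> M"
    and "\<And>n. nrm D (z n) = 1" "(\<lambda>n. nrm G (S (z n))) \<longlonglongrightarrow> M"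
    and "\<not> weakly_null D z"
    and "\<And>x. nrm D x = 1 \<Longrightarrow> nrm G (S x) \<noteq> M"
  shows "\<not> WMP D G"
proof -
  have "op_norm D G S = M" using assms(2-5) by (rule op_norm_eqI)
  with assms show ?thesis
    unfolding WMP_def maximizing_seq_def attains_norm_def bounded_op_def by metis
qed

section \<open>Direct sums\<close>

lemma vector_space_pair:
  assumes "vector_space s1" and "vector_space s2"
  shows "vector_space (\<lambda>c (x, y). (s1 c x, s2 c y))"
proof -
  interpret v1: vector_space s1 by fact
  interpret v2: vector_space s2 by fact
  show ?thesis
    by unfold_locales (auto simp: v1.scale_right_distrib v2.scale_right_distrib
        v1.scale_left_distrib v2.scale_left_distrib)
qed

lemma linear_snd_pair:
  assumes "vector_space s1" and "Vector_Spaces.linear s2 s3 \<phi>"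
  shows "Vector_Spaces.linear (\<lambda>c (x, y). (s1 c x, s2 c y)) s3 (\<lambda>z. \<phi> (snd z))"
  using assms vector_space_pair[of s1 s2] unfolding Vector_Spaces.linear_iff by auto

section \<open>Comparison of the p-norms of a pair of real numbers\<close>

definition lp_norm :: "real \<Rightarrow> real \<Rightarrow> real \<Rightarrow> real" where
  "lp_norm p a b = (a powr p + b powr p) powr (1 / p)"

lemma nrm_sum_p: "nrm (sum_p p E X) z = lp_norm p (nrm E (fst z)) (nrm X (snd z))"
  by (simp add: sum_p_def lp_norm_def split: prod.split)

lemma lp_norm_scale:
  assumes "0 < p" "0 \<le> c"
  shows "lp_norm p (c * a) (c * b) = c * lp_norm p a b"
proof -
  have "lp_norm p (c * a) (c * b) = (c powr p * (a powr p + b powr p)) powr (1 / p)"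
    by (simp add: lp_norm_def powr_mult distrib_left)
  also have "\<dots> = c * lp_norm p a b"
    using assms by (simp add: lp_norm_def powr_mult powr_powr)
  finally show ?thesis .
qed

lemma lp_norm_mono:
  assumes "0 < p" "0 \<le> a" "a \<le> a'" "0 \<le> b" "b \<le> b'"
  shows "lp_norm p a b \<le> lp_norm p a' b'"
  unfolding lp_norm_def using assms by (intro powr_mono2 add_mono add_nonneg_nonneg) auto

lemma lp_norm_strict_mono:
  assumes "0 < p" "0 \<le> a" "a < a'" "0 \<le> b" "b \<le> b'"
  shows "lp_norm p a b < lp_norm p a' b'"
  unfolding lp_norm_def using assms
  by (intro powr_less_mono2 add_less_le_mono powr_mono2 add_nonneg_nonneg) auto

lemma snd_le_lp_norm:
  assumes "0 < p" "0 \<le> b"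
  shows "b \<le> lp_norm p a b"
proof -
  have "b = (b powr p) powr (1 / p)" using assms by (simp add: powr_powr)
  also have "\<dots> \<le> lp_norm p a b"
    unfolding lp_norm_def using assms by (intro powr_mono2) auto
  finally show ?thesis .
qed

lemma lp_norm_1_1: "lp_norm p 1 1 = 2 powr (1 / p)"
  by (simp add: lp_norm_def)

lemma powr_midpoint_le:
  fixes A B r :: real
  assumes "0 \<le> A" "0 \<le> B" "1 \<le> r"
  shows "((A + B) / 2) powr r \<le> (A powr r + B powr r) / 2"
proof -
  \<comment> \<open>This covers the case that \<open>A\<close> or \<open>B\<close> is 0.\<close>
  have half: "(C / 2) powr r \<le> C powr r / 2" if "0 \<le> C" for C :: real
  proof -
    have "(1 / 2 :: real) powr r \<le> 1 / 2"
      using powr_mono'[of 1 r "1 / 2 :: real"] assms by simp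
    then have "C powr r * (1 / 2) powr r \<le> C powr r * (1 / 2)" by (intro mult_left_mono) auto
    then show ?thesis using powr_mult[of C "1 / 2" r] that by simp
  qed
  consider "A = 0" | "B = 0" | "0 < A" "0 < B" using assms by linarith
  then show ?thesis
  proof cases
    case 3
    have "(((1 - 1/2) *\<^sub>R A + (1/2) *\<^sub>R B)) powr r \<le> (1 - 1/2) * A powr r + (1/2) * B powr r"
      using 3 by (intro convex_onD[OF powr_convex[OF \<open>1 \<le> r\<close>]]) auto
    then show ?thesis by (simp add: add_divide_distrib)
  qed (use half assms in auto)
qed

text \<open>Midpoint convexity with exponent \<open>p / q\<close> at \<open>a powr q\<close> and
  \<open>b powr q\<close>, followed by a root of order \<open>p\<close>. Equality holds for
  \<open>a = b\<close>, which is why the counterexample below balances its two coordinates.\<close>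

lemma lp_norm_le_lp_norm:
  assumes "0 < q" "q \<le> p" "0 \<le> a" "0 \<le> b"
  shows "lp_norm q a b \<le> 2 powr (1 / q - 1 / p) * lp_norm p a b"
proof -
  have p: "0 < p" using assms by simp
  let ?A = "a powr q" and ?B = "b powr q"
  have "((?A + ?B) / 2) powr (p / q) \<le> (?A powr (p / q) + ?B powr (p / q)) / 2"
    using assms by (intro powr_midpoint_le) auto
  also have "\<dots> = (a powr p + b powr p) / 2"
    using assms by (simp add: powr_powr)
  finally have "(((?A + ?B) / 2) powr (p / q)) powr (1 / p) \<le> ((a powr p + b powr p) / 2) powr (1 / p)"
    using p by (intro powr_mono2) auto
  moreover have "(((?A + ?B) / 2) powr (p / q)) powr (1 / p) = lp_norm q a b / 2 powr (1 / q)"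
    using p assms by (simp add: powr_powr powr_divide lp_norm_def)
  moreover have "((a powr p + b powr p) / 2) powr (1 / p) = lp_norm p a b / 2 powr (1 / p)"
    by (simp add: powr_divide lp_norm_def)
  ultimately show ?thesis by (simp add: powr_diff field_simps)
qed

text \<open>A bounded functional on \<open>X\<close> composed with the second projection is bounded
  on \<open>D\<close> once the norm of \<open>D\<close> dominates that of the second coordinate. In
  this form it serves both kinds of sum.\<close>

lemma not_weakly_null_sum:
  assumes vs: "vector_space (scl E)"
    and D: "scl D = (\<lambda>c (x, y). (scl E c x, scl X c y))"
    and le: "\<And>z. nrm X (snd z) \<le> nrm D z"
    and X: "normed_space X"
    and \<phi>: "bounded_op X scalar_space \<phi>" "\<not> (\<lambda>n. \<phi> (snd (z n))) \<longlonglongrightarrow> 0"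
  shows "\<not> weakly_null D z"
proof -
  obtain B where B: "\<And>y. nrm scalar_space (\<phi> y) \<le> B * nrm X y"
    using \<phi>(1) by (auto simp: bounded_op_def)
  interpret X: normed_space X by fact
  have "nrm scalar_space (\<phi> (snd z)) \<le> \<bar>B\<bar> * nrm D z" for z
  proof -
    have "nrm scalar_space (\<phi> (snd z)) \<le> \<bar>B\<bar> * nrm X (snd z)"
      using B[of "snd z"] mult_right_mono[OF abs_ge_self[of B] X.nrm_nonneg[of "snd z"]] by simp
    also have "\<dots> \<le> \<bar>B\<bar> * nrm D z" by (intro mult_left_mono le) simp
    finally show ?thesis .
  qed
  moreover have "Vector_Spaces.linear (scl D) (scl scalar_space) (\<lambda>z. \<phi> (snd z))"
    unfolding D using vs \<phi>(1) by (intro linear_snd_pair) (auto simp: bounded_op_def)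
  ultimately have "bounded_op D scalar_space (\<lambda>z. \<phi> (snd z))"
    unfolding bounded_op_def by blast
  with \<phi>(2) show ?thesis unfolding weakly_null_def by blast
qed

section \<open>The counterexample for the maximum norm\<close>

lemma not_WMP_sum_inf:
  fixes E :: "('k::real_or_complex, 'e::ab_group_add) nspace"
    and X :: "('k, 'x::ab_group_add) nspace"
  assumes E: "normed_space E" and F: "normed_space F" and X: "normed_space X"
    and nontriv: "\<exists>x::'e. x \<noteq> 0" "\<exists>x::'x. x \<noteq> 0"
    and T: "bounded_op E F T" "\<not> attains_norm E F T"
  shows "\<not> WMP (sum_inf E X) F"
proof -
  interpret E: normed_space E by fact
  interpret F: normed_space F by fact
  interpret X: normed_space X by fact
  let ?N = "op_norm E F T"
  have N: "0 < ?N" using op_norm_pos_if_not_attains_norm[OF E F T(1) nontriv(1) T(2)] .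
  obtain x where "maximizing_seq E F T x"
    using exists_maximizing_seq[OF E F T(1) nontriv(1)] .
  then have x: "\<And>n. nrm E (x n) = 1" "(\<lambda>n. nrm F (T (x n))) \<longlonglongrightarrow> ?N"
    by (auto simp: maximizing_seq_def)
  obtain y where y: "nrm X y = 1" using nontriv(2) X.exists_nrm_eq[of _ 1] by auto
  then have "y \<noteq> 0" by auto
  then obtain \<phi> where \<phi>: "bounded_op X scalar_space \<phi>" "\<phi> y \<noteq> 0"
    by (rule X.exists_functional)
  have T_le: "nrm F (T v) \<le> ?N * nrm E v" for v by (rule nrm_le_op_norm[OF E F T(1)])
  have nrm: "nrm (sum_inf E X) z = max (nrm E (fst z)) (nrm X (snd z))" for z
    by (simp add: sum_inf_def split: prod.split)
  have scl: "scl (sum_inf E X) = (\<lambda>c (x, y). (scl E c x, scl X c y))"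
    by (simp add: sum_inf_def)
  show ?thesis
  proof (rule not_WMP_I[where S = "\<lambda>z. T (fst z)" and M = ?N and z = "\<lambda>n. (x n, y)"])
    show "Vector_Spaces.linear (scl (sum_inf E X)) (scl F) (\<lambda>z. T (fst z))"
      using T(1) vector_space_pair[OF E.vector_space_axioms X.vector_space_axioms]
      unfolding scl bounded_op_def Vector_Spaces.linear_iff by auto
    show "nrm F (T (fst z)) \<le> ?N * nrm (sum_inf E X) z" for z
      using T_le[of "fst z"] by (rule order_trans) (use N in \<open>simp add: nrm\<close>)
    show "nrm (sum_inf E X) (x n, y) = 1" for n using x(1) y by (simp add: nrm)
    show "(\<lambda>n. nrm F (T (fst (x n, y)))) \<longlonglongrightarrow> ?N" using x(2) by simp
    show "\<not> weakly_null (sum_inf E X) (\<lambda>n. (x n, y))"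
      by (rule not_weakly_null_sum[OF E.vector_space_axioms scl _ X \<phi>(1)])
        (use \<phi>(2) in \<open>simp_all add: nrm LIMSEQ_const_iff\<close>)
    show "nrm F (T (fst z)) \<noteq> ?N" if "nrm (sum_inf E X) z = 1" for z
    proof
      assume eq: "nrm F (T (fst z)) = ?N"
      \<comment> \<open>A point of attainment has its first coordinate in the unit ball, with image
        of norm \<open>?N\<close>. This puts it on the sphere, where \<open>T\<close> itself would
        attain its norm.\<close>
      have "nrm E (fst z) \<le> 1" using that nrm[of z] by linarith
      moreover from eq have "?N * 1 \<le> ?N * nrm E (fst z)" using T_le[of "fst z"] by simp
      ultimately have "nrm E (fst z) = 1" using N by (simp only: mult_le_cancel_left_pos)
      with eq T(2) show False unfolding attains_norm_def by blast
    qed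
  qed (use N in simp)
qed

section \<open>The counterexample for finite exponents\<close>

lemma exists_functional_maximizing:
  fixes X :: "('k::real_or_complex, 'x::ab_group_add) nspace"
  assumes X: "normed_space X" and nontriv: "\<exists>x::'x. x \<noteq> 0"
  obtains \<phi> y where "bounded_op X scalar_space \<phi>" "0 < op_norm X scalar_space \<phi>"
    "maximizing_seq X scalar_space \<phi> y"
proof -
  interpret X: normed_space X by fact
  obtain x :: 'x where x: "x \<noteq> 0" using nontriv by blast
  then obtain \<phi> where \<phi>: "bounded_op X scalar_space \<phi>" "\<phi> x \<noteq> 0"
    by (rule X.exists_functional)
  have "0 < norm (\<phi> x)" using \<phi>(2) by simp
  also have "norm (\<phi> x) \<le> op_norm X scalar_space \<phi> * nrm X x"
    using nrm_le_op_norm[OF X normed_space_scalar \<phi>(1), of x] by (simp add: scalar_space_def)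
  finally have "0 < op_norm X scalar_space \<phi>"
    using X.nrm_nonneg[of x] by (simp add: zero_less_mult_iff)
  with \<phi>(1) show thesis
    using that exists_maximizing_seq[OF X normed_space_scalar \<phi>(1) nontriv] by metis
qed

lemma not_WMP_sum_p:
  fixes E :: "('k::real_or_complex, 'e::ab_group_add) nspace"
    and X :: "('k, 'x::ab_group_add) nspace"
    and Y :: "('k, 'y::ab_group_add) nspace"
  assumes E: "normed_space E" and F: "normed_space F" and X: "normed_space X" and Y: "normed_space Y"
    and nontriv: "\<exists>x::'e. x \<noteq> 0" "\<exists>x::'x. x \<noteq> 0" "\<exists>x::'y. x \<noteq> 0"
    and T: "bounded_op E F T" "\<not> attains_norm E F T"
    and pq: "0 < q" "q < p"
  shows "\<not> WMP (sum_p p E X) (sum_p q F Y)"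
proof -
  interpret E: normed_space E by fact
  interpret F: normed_space F by fact
  interpret X: normed_space X by fact
  interpret Y: normed_space Y by fact
  interpret T: Vector_Spaces.linear "scl E" "scl F" T
    using T(1) by (simp add: bounded_op_def)
  let ?N = "op_norm E F T"
  have p: "0 < p" using pq by simp
  have N: "0 < ?N" using op_norm_pos_if_not_attains_norm[OF E F T(1) nontriv(1) T(2)] .
  have T_le: "nrm F (T v) \<le> ?N * nrm E v" for v by (rule nrm_le_op_norm[OF E F T(1)])
  obtain x where "maximizing_seq E F T x"
    using exists_maximizing_seq[OF E F T(1) nontriv(1)] .
  then have x: "\<And>n. nrm E (x n) = 1" "(\<lambda>n. nrm F (T (x n))) \<longlonglongrightarrow> ?N"
    by (auto simp: maximizing_seq_def)

  obtain \<phi> y where \<phi>: "bounded_op X scalar_space \<phi>" "0 < op_norm X scalar_space \<phi>"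
    and max: "maximizing_seq X scalar_space \<phi> y"
    using exists_functional_maximizing[OF X nontriv(2)] .
  let ?G = "op_norm X scalar_space \<phi>"
  interpret \<phi>: Vector_Spaces.linear "scl X" "scl scalar_space" \<phi>
    using \<phi>(1) by (simp add: bounded_op_def)
  have \<phi>_scale: "\<phi> (scl X c v) = c * \<phi> v" for c v
    using \<phi>.scale[of c v] by (simp add: scalar_space_def)
  have y: "\<And>n. nrm X (y n) = 1" "(\<lambda>n. norm (\<phi> (y n))) \<longlonglongrightarrow> ?G"
    using max by (auto simp: maximizing_seq_def scalar_space_def)
  \<comment> \<open>This length gives the rank one operator \<open>?R\<close> the same norm as
    \<open>T\<close>.\<close>
  obtain w where w: "nrm Y w = ?N / ?G"
    using nontriv(3) Y.exists_nrm_eq[of _ "?N / ?G"] N \<phi>(2) by fastforce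
  let ?R = "\<lambda>v. scl Y (\<phi> v) w"
  have nrm_R: "nrm Y (?R v) = norm (\<phi> v) * (?N / ?G)" for v
    by (simp add: Y.nrm_scl w)
  have R_le: "nrm Y (?R v) \<le> ?N * nrm X v" for v
  proof -
    have "norm (\<phi> v) \<le> ?G * nrm X v"
      using nrm_le_op_norm[OF X normed_space_scalar \<phi>(1), of v] by (simp add: scalar_space_def)
    then have "norm (\<phi> v) * (?N / ?G) \<le> ?G * nrm X v * (?N / ?G)"
      using N \<phi>(2) by (intro mult_right_mono) auto
    then show ?thesis using \<phi>(2) by (simp add: nrm_R mult.commute)
  qed
  have R_lim: "(\<lambda>n. nrm Y (?R (y n))) \<longlonglongrightarrow> ?N"
    using tendsto_mult_right[OF y(2), of "?N / ?G"] \<phi>(2) by (simp add: nrm_R)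

  let ?D = "sum_p p E X" and ?H = "sum_p q F Y"
  \<comment> \<open>\<open>?K\<close> is the constant of \<open>lp_norm_le_lp_norm\<close>;
    \<open>?c\<close> is the inverse of \<open>lp_norm p 1 1\<close> and normalizes a pair of unit
    vectors.\<close>
  let ?K = "2 powr (1 / q - 1 / p) :: real"
  let ?c = "2 powr (- (1 / p)) :: real"
  define S where "S z = (T (fst z), ?R (snd z))" for z
  define z where "z n = (scl E (of_real ?c) (x n), scl X (of_real ?c) (y n))" for n
  have scl: "scl ?D = (\<lambda>c (x, y). (scl E c x, scl X c y))" "scl ?H = (\<lambda>c (x, y). (scl F c x, scl Y c y))"
    by (simp_all add: sum_p_def)
  \<comment> \<open>The strict inequality \<open>q < p\<close> enters here.\<close>
  have K: "1 < ?K" using pq by (simp add: field_simps)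
  have S_le': "nrm ?H (S v) \<le> ?N * lp_norm q (nrm E (fst v)) (nrm X (snd v))" for v
  proof -
    have "nrm ?H (S v) \<le> lp_norm q (?N * nrm E (fst v)) (?N * nrm X (snd v))"
      unfolding nrm_sum_p S_def using pq T_le R_le by (intro lp_norm_mono) auto
    also have "\<dots> = ?N * lp_norm q (nrm E (fst v)) (nrm X (snd v))"
      using pq N by (intro lp_norm_scale) auto
    finally show ?thesis .
  qed
  have le_K: "?N * lp_norm q (nrm E (fst v)) (nrm X (snd v)) \<le> ?N * ?K * nrm ?D v" for v
    using lp_norm_le_lp_norm[of q p "nrm E (fst v)" "nrm X (snd v)"] pq N
    by (simp add: nrm_sum_p)
  show ?thesis
  proof (rule not_WMP_I[where S = S and M = "?N * ?K" and z = z])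
    show "Vector_Spaces.linear (scl ?D) (scl ?H) S"
      unfolding Vector_Spaces.linear_iff scl
      using vector_space_pair[OF E.vector_space_axioms X.vector_space_axioms]
        vector_space_pair[OF F.vector_space_axioms Y.vector_space_axioms]
      by (auto simp: S_def T.add T.scale \<phi>.add \<phi>_scale Y.scale_left_distrib)
    show "nrm ?H (S v) \<le> ?N * ?K * nrm ?D v" for v
      using S_le' le_K by (rule order_trans)
    show "0 \<le> ?N * ?K" using N by simp
    show "nrm ?D (z n) = 1" for n
      using lp_norm_scale[OF p, of ?c 1 1]
      by (simp add: nrm_sum_p z_def E.nrm_scl X.nrm_scl x(1) y(1) lp_norm_1_1 powr_minus norm_inverse)
    show "(\<lambda>n. nrm ?H (S (z n))) \<longlonglongrightarrow> ?N * ?K"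
    proof -
      have "nrm ?H (S (z n)) = ?c * lp_norm q (nrm F (T (x n))) (nrm Y (?R (y n)))" for n
        using lp_norm_scale[OF pq(1), of ?c "nrm F (T (x n))" "nrm Y (?R (y n))"]
        by (simp add: nrm_sum_p S_def z_def T.scale \<phi>_scale F.nrm_scl Y.nrm_scl norm_mult mult.assoc)
      moreover have "(\<lambda>n. ?c * lp_norm q (nrm F (T (x n))) (nrm Y (?R (y n))))
          \<longlonglongrightarrow> ?c * lp_norm q ?N ?N"
        unfolding lp_norm_def using x(2) R_lim N pq by (intro tendsto_intros) auto
      moreover have "?c * lp_norm q ?N ?N = ?N * ?K"
        using lp_norm_scale[OF pq(1), of ?N 1 1] N
        by (simp add: lp_norm_1_1 powr_diff powr_minus field_simps)
      ultimately show ?thesis by simp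
    qed
    show "\<not> weakly_null ?D z"
    proof (rule not_weakly_null_sum[OF E.vector_space_axioms scl(1) _ X \<phi>(1)])
      show "nrm X (snd v) \<le> nrm ?D v" for v
        using p by (simp add: nrm_sum_p snd_le_lp_norm)
      \<comment> \<open>The scalars \<open>\<phi> (y n)\<close> need not converge, but their
        absolute values tend to \<open>?G > 0\<close>.\<close>
      show "\<not> (\<lambda>n. \<phi> (snd (z n))) \<longlonglongrightarrow> 0"
      proof
        assume "(\<lambda>n. \<phi> (snd (z n))) \<longlonglongrightarrow> 0"
        then have "(\<lambda>n. ?c * norm (\<phi> (y n))) \<longlonglongrightarrow> 0"
          by (subst (asm) tendsto_norm_zero_iff[symmetric]) (simp add: z_def \<phi>_scale norm_mult)
        moreover have "(\<lambda>n. ?c * norm (\<phi> (y n))) \<longlonglongrightarrow> ?c * ?G"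
          by (intro tendsto_mult_left y)
        ultimately have "?c * ?G = 0" by (rule LIMSEQ_unique[rotated])
        with \<phi>(2) show False by simp
      qed
    qed
    show "nrm ?H (S v) \<noteq> ?N * ?K" if v: "nrm ?D v = 1" for v
    proof
      assume eq: "nrm ?H (S v) = ?N * ?K"
      let ?a = "nrm E (fst v)" and ?b = "nrm X (snd v)"
      have le1: "lp_norm q (?N * ?a) (?N * ?b) \<le> ?N * ?K"
        using le_K[of v] v lp_norm_scale[OF pq(1), of ?N ?a ?b] N by simp
      \<comment> \<open>Any loss in the first coordinate would, by strict monotonicity of the
        q-norm, leave the norm of \<open>S v\<close> strictly below \<open>?N * ?K\<close>.\<close>
      have "nrm F (T (fst v)) = ?N * ?a"
      proof (rule ccontr)
        assume "nrm F (T (fst v)) \<noteq> ?N * ?a"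
        with T_le[of "fst v"] have "nrm F (T (fst v)) < ?N * ?a" by simp
        then have "nrm ?H (S v) < lp_norm q (?N * ?a) (?N * ?b)"
          unfolding nrm_sum_p S_def using pq R_le by (intro lp_norm_strict_mono) auto
        with le1 eq show False by simp
      qed
      \<comment> \<open>For a pair with first coordinate 0 the q-norm and the p-norm agree, so the
        norm of \<open>S v\<close> is at most \<open>?N\<close>, which is less than
        \<open>?N * ?K\<close>.\<close>
      moreover have "fst v \<noteq> 0"
      proof
        assume "fst v = 0"
        then have "lp_norm r ?a ?b = ?b" if "0 < r" for r
          using that by (simp add: lp_norm_def powr_powr)
        then have "nrm ?H (S v) \<le> ?N * 1"
          using S_le'[of v] v pq p by (simp add: nrm_sum_p)
        with eq have "?N * ?K \<le> ?N * 1" by simp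
        with N K show False by (simp only: mult_le_cancel_left_pos)
      qed
      ultimately show False using attains_norm_if_nrm_eq[OF E F T(1)] T(2) by blast
    qed
  qed
qed

theorem theorem2p1:
  fixes E :: "('k::real_or_complex, 'e::ab_group_add) nspace"
    and F :: "('k, 'f::ab_group_add) nspace"
    and X :: "('k, 'x::ab_group_add) nspace"
    and Y :: "('k, 'y::ab_group_add) nspace"
  assumes "banach_space E" and "banach_space F" and "banach_space X" and "banach_space Y"
    and "\<exists>x::'e. x \<noteq> 0" and "\<exists>x::'f. x \<noteq> 0" and "\<exists>x::'x. x \<noteq> 0" and "\<exists>x::'y. x \<noteq> 0"
    and "\<exists>T. bounded_op E F T \<and> \<not> attains_norm E F T"
  shows "(\<forall>p q::real. 1 \<le> q \<and> q < p \<longrightarrow> \<not> WMP (sum_p p E X) (sum_p q F Y))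
       \<and> \<not> WMP (sum_inf E X) F"
proof -
  obtain T where T: "bounded_op E F T" "\<not> attains_norm E F T" using assms(9) by blast
  note ns = assms(1-4)[THEN banach_space.axioms(1)]
  have "\<not> WMP (sum_p p E X) (sum_p q F Y)" if "1 \<le> q" "q < p" for p q
    using that by (intro not_WMP_sum_p[OF ns assms(5,7,8) T]) auto
  moreover have "\<not> WMP (sum_inf E X) F"
    by (rule not_WMP_sum_inf[OF ns(1-3) assms(5,7) T])
  ultimately show ?thesis by blast
qed

end
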